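(* Let $\mathcal{C}$ be a binary cyclic code. Then the automorphism group $\operatorname{Aut}(\mathcal{C})$ is not isomorphic, as an abstract group, to a non-trivial cyclic group of odd order.
   Context: A binary linear code of length $N$ ($N$ a positive integer) is a linear subspace $\mathcal{C}$ of $\mathbb{F}_2^N$. The symmetric group $\operatorname{Sym}(N)$ acts on $\mathbb{F}_2^N$ by coordinate permutations, and $\operatorname{Aut}(\mathcal{C})\le\operatorname{Sym}(N)$ is the subgroup of all permutations mapping the subspace $\mathcal{C}$ into itself. The code $\mathcal{C}$ is called cyclic if $\operatorname{Aut}(\mathcal{C})$ contains a regular cycle of length $N$ (i.e. an $N$-cycle). *)

theory Defs
  imports
    "HOL-Analysis.Cartesian_Space"
    "HOL-Library.Z2"
    "HOL-Combinatorics.Orbits"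
    "HOL-Algebra.Bij"
    "HOL-Algebra.Elementary_Groups"
begin

text \<open>
  The two-element field is \<^typ>\<open>bit\<close>, and words of length \<open>N = CARD('n)\<close> are elements of
  \<open>bit ^ 'n\<close>; the coordinate positions are the elements of the finite type \<open>'n\<close>.
\<close>

definition linear_code :: "(bit ^ 'n) set \<Rightarrow> bool"
  where "linear_code C \<longleftrightarrow> vec.subspace C"

text \<open>
  The inverse makes this a left action: the entry at position \<open>j\<close> moves to position \<open>\<sigma> j\<close>.
\<close>

definition permute_coords :: "('n \<Rightarrow> 'n) \<Rightarrow> bit ^ 'n \<Rightarrow> bit ^ 'n"
  where "permute_coords \<sigma> v = (\<chi> i. v $ inv_into UNIV \<sigma> i)"

definition code_automorphisms :: "(bit ^ 'n) set \<Rightarrow> ('n \<Rightarrow> 'n) set"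
  where "code_automorphisms C = {\<sigma> \<in> Bij UNIV. permute_coords \<sigma> ` C \<subseteq> C}"

text \<open>
  \<^term>\<open>BijGroup UNIV\<close> is the symmetric group on the coordinate positions; see
  \<open>subgroup_code_automorphisms\<close> below.
\<close>

definition code_Aut :: "(bit ^ 'n) set \<Rightarrow> ('n \<Rightarrow> 'n) monoid"
  where "code_Aut C = (BijGroup UNIV)\<lparr>carrier := code_automorphisms C\<rparr>"

text \<open>
  For a bijection, \<^term>\<open>cyclic_on \<sigma> UNIV\<close> says that all positions form a single cycle of
  \<open>\<sigma>\<close>, i.e. \<open>\<sigma>\<close> is an \<open>N\<close>-cycle (the identity if \<open>N = 1\<close>).
\<close>

definition cyclic_code :: "(bit ^ 'n) set \<Rightarrow> bool"
  where "cyclic_code C \<longleftrightarrow>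
    linear_code C \<and> (\<exists>\<sigma> \<in> code_automorphisms C. cyclic_on \<sigma> UNIV)"

lemma Bij_UNIV [simp]: "\<sigma> \<in> Bij UNIV \<longleftrightarrow> bij \<sigma>"
  by (simp add: Bij_def)

lemma restrict_UNIV: "restrict f UNIV = f"
  by (simp add: restrict_def)

lemma permute_coords_nth: "bij \<sigma> \<Longrightarrow> permute_coords \<sigma> v $ \<sigma> j = v $ j"
  by (simp add: permute_coords_def bij_is_inj)

lemma permute_coords_id [simp]: "permute_coords (\<lambda>x. x) v = v"
  by (simp add: permute_coords_def vec_eq_iff inv_f_eq)

lemma permute_coords_comp:
  assumes "bij \<sigma>" "bij \<tau>"
  shows "permute_coords (\<lambda>x. \<sigma> (\<tau> x)) v = permute_coords \<sigma> (permute_coords \<tau> v)"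
  using o_inv_distrib[OF assms] by (simp add: permute_coords_def vec_eq_iff o_def)

lemma mult_code_Aut:
  "bij \<sigma> \<Longrightarrow> bij \<tau> \<Longrightarrow> \<sigma> \<otimes>\<^bsub>code_Aut C\<^esub> \<tau> = (\<lambda>x. \<sigma> (\<tau> x))"
  by (simp add: code_Aut_def BijGroup_def compose_def restrict_UNIV)

lemma subgroup_code_automorphisms:
  fixes C :: "(bit ^ 'n) set"
  shows "subgroup (code_automorphisms C) (BijGroup UNIV)"
proof -
  interpret G: group "BijGroup (UNIV :: 'n set)"
    by (rule group_BijGroup)
  have fin: "finite C"
  proof (rule inj_on_finite)
    show "inj_on (\<lambda>v. {i. v $ i = 1}) C"
    proof (rule inj_onI)
      fix v w :: "bit ^ 'n" assume eq: "{i. v $ i = 1} = {i. w $ i = 1}"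
      show "v = w"
      proof (rule vec_eq_iff[THEN iffD2], rule allI)
        fix i
        have "v $ i = 1 \<longleftrightarrow> w $ i = 1"
          using eq by blast
        then show "v $ i = w $ i"
          by (cases "v $ i"; cases "w $ i") simp_all
      qed
    qed
  qed auto
  show ?thesis
  proof (rule G.subgroupI)
    show "code_automorphisms C \<subseteq> carrier (BijGroup UNIV)"
      by (auto simp: code_automorphisms_def BijGroup_def)
    have "(\<lambda>x. x) \<in> code_automorphisms C"
      by (auto simp: code_automorphisms_def bij_def)
    then show "code_automorphisms C \<noteq> {}"
      by blast
  next
    fix \<sigma> \<tau> assume *: "\<sigma> \<in> code_automorphisms C" "\<tau> \<in> code_automorphisms C"
    then have b: "bij \<sigma>" "bij \<tau>"
      by (auto simp: code_automorphisms_def)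
    have "bij (\<lambda>x. \<sigma> (\<tau> x))"
      using bij_comp[OF b(2,1)] by (simp add: o_def)
    with * b show "\<sigma> \<otimes>\<^bsub>BijGroup UNIV\<^esub> \<tau> \<in> code_automorphisms C"
      by (auto simp: code_automorphisms_def BijGroup_def compose_def restrict_UNIV
          permute_coords_comp[OF b])
  next
    fix \<sigma> assume *: "\<sigma> \<in> code_automorphisms C"
    then have b: "bij \<sigma>" and sub: "permute_coords \<sigma> ` C \<subseteq> C"
      by (auto simp: code_automorphisms_def)
    let ?\<tau> = "inv_into UNIV \<sigma>"
    have b': "bij ?\<tau>"
      using b by (rule bij_imp_bij_inv)
    have left: "permute_coords ?\<tau> (permute_coords \<sigma> v) = v" for v
      using permute_coords_comp[OF b' b, of v] b by (simp add: bij_is_inj)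
    have "inj_on (permute_coords \<sigma>) C"
      using left by (metis inj_onI)
    then have im: "permute_coords \<sigma> ` C = C"
      using endo_inj_surj[OF fin sub] by blast
    have "permute_coords ?\<tau> ` C \<subseteq> C"
    proof (rule image_subsetI)
      fix v assume "v \<in> C"
      then obtain w where "w \<in> C" "v = permute_coords \<sigma> w"
        using im by blast
      then show "permute_coords ?\<tau> v \<in> C"
        by (simp add: left)
    qed
    moreover have "m_inv (BijGroup UNIV) \<sigma> = ?\<tau>"
      using b b' by (intro G.inv_equality)
        (auto simp: BijGroup_def compose_def restrict_UNIV bij_is_inj)
    ultimately show "m_inv (BijGroup UNIV) \<sigma> \<in> code_automorphisms C"
      using b' by (simp add: code_automorphisms_def)
  qed
qed

lemma group_code_Aut: "group (code_Aut C)"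
  unfolding code_Aut_def
  by (rule subgroup.subgroup_is_group[OF subgroup_code_automorphisms group_BijGroup])

end

theory Submission
  imports Defs "HOL-Algebra.Multiplicative_Group"
begin

text \<open>
  Identify the positions with \<open>\<int>/N\<close> so that the given \<open>N\<close>-cycle \<open>\<sigma>\<close> becomes \<open>j \<mapsto> j + 1\<close>. A
  word is then a polynomial \<open>v(x)\<close> modulo \<open>x^N - 1\<close> over the field with two elements, and the code
  is an ideal. An ideal contains \<open>v(x)^2\<close> along with \<open>v(x)\<close>, and in characteristic two
  \<open>v(x)^2 = v(x^2)\<close>, which for odd \<open>N\<close> is the word \<open>v\<close> permuted by \<open>\<mu>: j \<mapsto> 2 j\<close>. So every binary
  cyclic code of odd length has the doubling map \<open>\<mu>\<close> among its automorphisms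
  (\<open>doubling_automorphism\<close>).

  Suppose now that the automorphism group is abelian of odd order. If \<open>N\<close> were even, \<open>\<sigma>^(N/2)\<close>
  would be an element of order two; so \<open>N\<close> is odd and \<open>\<mu>\<close> is available. Commutation of \<open>\<mu>\<close> with \<open>\<sigma>\<close>
  says that \<open>2 (j + 1) = 2 j + 1\<close> modulo \<open>N\<close>, hence \<open>N = 1\<close>
  (\<open>cyclic_code_abelian_odd_Aut_length\<close>), and on a single position the only permutation is the
  identity. A cyclic group is abelian, so no non-trivial one of odd order can occur.
\<close>

section \<open>Powers of a full cycle\<close>

lemma cyclic_on_UNIV_enumeration:
  fixes \<sigma> :: "'n::finite \<Rightarrow> 'n"
  assumes "cyclic_on \<sigma> UNIV"
  obtains a where "bij_betw (\<lambda>j. (\<sigma> ^^ j) a) {..<CARD('n)} UNIV"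
    and "\<sigma> ^^ CARD('n) = id"
proof -
  obtain a where a: "UNIV = orbit \<sigma> a"
    using assms by (auto simp: cyclic_on_def)
  have a_orb: "a \<in> orbit \<sigma> a"
    using a by blast
  let ?n = "funpow_dist1 \<sigma> a a"
  have bij: "bij_betw (\<lambda>j. (\<sigma> ^^ j) a) {..<?n} UNIV"
    using inj_on_funpow_dist1[OF a_orb] orbit_conv_funpow_dist1[OF a_orb] a
    by (simp add: bij_betw_def atLeast0LessThan)
  then have n: "?n = CARD('n)"
    using bij_betw_same_card by fastforce
  have "(\<sigma> ^^ ?n) x = x" for x
  proof -
    have "x \<in> (\<lambda>j. (\<sigma> ^^ j) a) ` {..<?n}"
      using bij_betw_imp_surj_on[OF bij] by (simp only: UNIV_I)
    then obtain j where x: "x = (\<sigma> ^^ j) a"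
      by blast
    have "(\<sigma> ^^ ?n) ((\<sigma> ^^ j) a) = (\<sigma> ^^ j) ((\<sigma> ^^ ?n) a)"
      by (simp only: funpow_add[THEN fun_cong, unfolded comp_apply, symmetric] add.commute)
    then show ?thesis
      by (simp only: x funpow_dist1_prop[OF a_orb])
  qed
  then have "\<sigma> ^^ ?n = id"
    by (intro ext) (simp only: id_apply)
  with bij show thesis
    by (intro that[of a]) (simp_all only: n)
qed

lemma code_Aut_pow:
  assumes "\<sigma> \<in> code_automorphisms C"
  shows "\<sigma> [^]\<^bsub>code_Aut C\<^esub> (k::nat) = \<sigma> ^^ k"
proof (induction k)
  case 0
  show ?case
    by (simp add: code_Aut_def BijGroup_def restrict_UNIV id_def)
next
  case (Suc k)
  have "bij \<sigma>"
    using assms by (simp add: code_automorphisms_def)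
  then have "\<sigma> ^^ k \<otimes>\<^bsub>code_Aut C\<^esub> \<sigma> = \<sigma> ^^ Suc k"
    by (simp add: mult_code_Aut bij_fn funpow_swap1 fun_eq_iff)
  with Suc show ?case
    by simp
qed

lemma code_automorphisms_funpow:
  assumes "\<sigma> \<in> code_automorphisms C"
  shows "\<sigma> ^^ k \<in> code_automorphisms C"
proof -
  have "\<sigma> [^]\<^bsub>code_Aut C\<^esub> k \<in> carrier (code_Aut C)"
    using assms by (intro monoid.nat_pow_closed group.is_monoid group_code_Aut)
      (simp add: code_Aut_def)
  then show ?thesis
    by (simp add: code_Aut_pow[OF assms]) (simp add: code_Aut_def)
qed

section \<open>Squaring in characteristic two\<close>

lemma sum_period_shift:
  fixes F :: "nat \<Rightarrow> 'a::ab_group_add"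
  assumes "\<And>j. F (j + n) = F j"
  shows "(\<Sum>t<n. F (h + t)) = (\<Sum>t<n. F t)"
proof (induction h)
  case (Suc h)
  have "F h + (\<Sum>t<n. F (h + Suc t)) = (\<Sum>t<n. F (h + t)) + F (h + n)"
    using sum.lessThan_Suc_shift[of "\<lambda>t. F (h + t)" n] by simp
  with Suc show ?case
    using assms[of h] by simp
qed simp

text \<open>
  The vanishing of the cross terms when squaring in characteristic two: the reflection
  \<open>t \<mapsto> n - t\<close> pairs equal summands, and for odd \<open>n\<close> it leaves only \<open>t = 0\<close> unpaired modulo \<open>n\<close>.
\<close>

lemma sum_bit_reflection:
  fixes g :: "nat \<Rightarrow> bit"
  assumes n: "odd n" and sym: "\<And>t. 0 < t \<Longrightarrow> t < n \<Longrightarrow> g (n - t) = g t"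
  shows "(\<Sum>t<n. g t) = g 0"
proof -
  obtain k where k: "n = 2 * k + 1"
    using n oddE by blast
  have "{..<n} = insert 0 ({1..k} \<union> {Suc k..2 * k})"
    by (auto simp: k)
  then have "(\<Sum>t<n. g t) = g 0 + ((\<Sum>t=1..k. g t) + (\<Sum>t=Suc k..2 * k. g t))"
    by (simp add: sum.union_disjoint)
  moreover have "(\<Sum>t=Suc k..2 * k. g t) = (\<Sum>t=1..k. g t)"
    by (rule sum.reindex_bij_witness[of _ "\<lambda>t. n - t" "\<lambda>t. n - t"])
      (auto simp: k intro!: sym[unfolded k, simplified] sym[unfolded k, simplified, symmetric])
  ultimately show ?thesis
    by simp
qed

text \<open>
  The word \<open>w\<close> in the proof is the product \<open>v(x) v(x)\<close> modulo \<open>x^N - 1\<close>, written as a linear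
  combination of cyclic shifts of \<open>v\<close>, so it lies in the code. Its coefficient at \<open>2 h\<close> is a sum of
  products of entries of \<open>v\<close> at positions \<open>h + t\<close> and \<open>h - t\<close>, which is symmetric in \<open>t\<close> and therefore
  collapses to the entry at \<open>h\<close>.
\<close>

lemma doubling_automorphism:
  fixes C :: "(bit ^ 'n) set"
  assumes C: "linear_code C" and \<sigma>: "\<sigma> \<in> code_automorphisms C"
    and enum: "bij_betw (\<lambda>j. (\<sigma> ^^ j) a) {..<CARD('n)} UNIV"
    and period: "\<sigma> ^^ CARD('n) = id" and odd: "odd CARD('n)"
  obtains \<mu> where "\<mu> \<in> code_automorphisms C"
    and "\<And>j. \<mu> ((\<sigma> ^^ j) a) = (\<sigma> ^^ (2 * j)) a"
proof -
  define N where "N = CARD('n)"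
  define p where "p j = (\<sigma> ^^ j) a" for j
  have bij_pow: "bij (\<sigma> ^^ j)" for j
    using \<sigma> by (simp add: code_automorphisms_def bij_fn)
  have pow_p: "(\<sigma> ^^ i) (p j) = p (i + j)" for i j
    by (simp add: p_def funpow_add)
  have pow_period: "\<sigma> ^^ (j + N) = \<sigma> ^^ j" for j
    using period by (simp add: funpow_add N_def)
  have p_period: "p (j + N) = p j" for j
    by (simp add: p_def pow_period)
  have p_surj: "\<exists>j<N. x = p j" for x
  proof -
    have "x \<in> p ` {..<N}"
      using bij_betw_imp_surj_on[OF enum] by (simp add: N_def p_def)
    then show ?thesis
      by blast
  qed

  define \<mu> where "\<mu> x = p (2 * inv_into {..<N} p x)" for x
  \<comment> \<open>The definition reads off the representative below \<open>N\<close>; by periodicity any other one will do.\<close>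
  have \<mu>_p: "\<mu> (p j) = p (2 * j)" for j
  proof (induction j rule: less_induct)
    case (less j)
    show ?case
    proof (cases "j < N")
      case True
      then have "inv_into {..<N} p (p j) = j"
        using bij_betw_imp_inj_on[OF enum] by (intro inv_into_f_f) (simp_all add: p_def[abs_def] N_def)
      then show ?thesis
        by (simp add: \<mu>_def)
    next
      case False
      have "N > 0"
        by (simp add: N_def)
      then have "\<mu> (p (j - N)) = p (2 * (j - N))"
        using False by (intro less) simp
      moreover have "p (j - N) = p j"
        using p_period[of "j - N"] False by simp
      moreover have "2 * (j - N) + N + N = 2 * j"
        using False by simp
      then have "p (2 * (j - N)) = p (2 * j)"
        using p_period by metis
      ultimately show ?thesis
        by simp
    qed
  qed
  have "surj \<mu>"
    unfolding surj_def
  proof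
    fix y
    obtain m where m: "y = p m"
      using p_surj by blast
    \<comment> \<open>As \<open>N\<close> is odd, one of the two representatives \<open>m\<close> and \<open>m + N\<close> can be halved.\<close>
    obtain k where "m = 2 * k \<or> m + N = 2 * k"
      using odd by (metis N_def evenE odd_even_add)
    then have "y = \<mu> (p k)"
      using m p_period \<mu>_p by metis
    then show "\<exists>x. y = \<mu> x"
      by blast
  qed
  then have bij_\<mu>: "bij \<mu>"
    by (simp add: bij_def finite_UNIV_surj_inj)

  have "permute_coords \<mu> v \<in> C" if v: "v \<in> C" for v
  proof -
    define w where "w = (\<Sum>j<N. v $ p j *s permute_coords (\<sigma> ^^ j) v)"
    have "w \<in> C"
      unfolding w_def using C v code_automorphisms_funpow[OF \<sigma>]
      by (auto simp: linear_code_def code_automorphisms_def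
          intro!: vec.subspace_sum vec.subspace_scale)
    have w_nth: "w $ p (2 * h) = v $ p h" for h
    proof -
      define F where "F j = v $ p j * permute_coords (\<sigma> ^^ j) v $ p (2 * h)" for j
      have F: "F (h + t) = v $ p (h + t) * v $ p (h + (N - t))" if "t \<le> N" for t
      proof -
        have "h + t + (h + (N - t)) = 2 * h + N"
          using that by simp
        then have "(\<sigma> ^^ (h + t)) (p (h + (N - t))) = p (2 * h)"
          by (metis pow_p p_period)
        then show ?thesis
          using permute_coords_nth[OF bij_pow] by (metis F_def)
      qed
      \<comment> \<open>Starting the sum over a full period at \<open>h\<close> centres it on the axis of its symmetry.\<close>
      have "w $ p (2 * h) = (\<Sum>j<N. F j)"
        by (simp add: w_def F_def)
      also have "\<dots> = (\<Sum>t<N. F (h + t))"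
        by (rule sum_period_shift[symmetric]) (simp add: F_def p_period pow_period)
      also have "\<dots> = F (h + 0)"
      proof (rule sum_bit_reflection)
        show "odd N"
          using odd by (simp add: N_def)
        show "F (h + (N - t)) = F (h + t)" if "t < N" for t
          using F[of t] F[of "N - t"] that by (simp only: diff_le_self less_imp_le
              diff_diff_cancel mult.commute)
      qed
      also have "\<dots> = v $ p h"
        using F[of 0] by (cases "v $ p h") (simp_all add: p_period)
      finally show ?thesis .
    qed
    have "w $ \<mu> x = permute_coords \<mu> v $ \<mu> x" for x
      using p_surj[of x] w_nth by (auto simp: permute_coords_nth[OF bij_\<mu>] \<mu>_p)
    then have "w = permute_coords \<mu> v"
      using \<open>surj \<mu>\<close> by (metis surjD vec_eq_iff)
    with \<open>w \<in> C\<close> show ?thesis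
      by simp
  qed
  then have "\<mu> \<in> code_automorphisms C"
    using bij_\<mu> by (auto simp: code_automorphisms_def)
  with \<mu>_p show thesis
    by (intro that) (simp_all add: p_def)
qed

section \<open>Abelian automorphism groups of odd order\<close>

lemma (in group) involution_eq_one_of_odd_order:
  assumes "odd (order G)" "x \<in> carrier G" "x [^] (2::nat) = \<one>"
  shows "x = \<one>"
proof -
  obtain k where "order G = 2 * k + 1"
    using assms(1) oddE by blast
  then have "x [^] order G = (x [^] (2::nat)) [^] k \<otimes> x"
    using assms(2) by (simp add: nat_pow_pow)
  then show ?thesis
    using assms by (simp add: pow_order_eq_1)
qed

text \<open>
  Evaluating \<open>\<mu> \<sigma> = \<sigma> \<mu>\<close> at the base point \<open>a\<close>, which \<open>\<mu>\<close> fixes, gives \<open>\<sigma> (\<sigma> a) = \<sigma> a\<close>, so \<open>\<sigma>\<close> fixes \<open>a\<close>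
  as well; but \<open>\<sigma>\<close> moves all positions in one cycle.
\<close>

lemma cyclic_code_abelian_odd_Aut_length:
  fixes C :: "(bit ^ 'n) set"
  assumes "cyclic_code C" and odd: "odd (order (code_Aut C))"
    and comm: "\<And>\<sigma> \<tau>. \<sigma> \<in> code_automorphisms C \<Longrightarrow> \<tau> \<in> code_automorphisms C \<Longrightarrow>
      \<sigma> \<otimes>\<^bsub>code_Aut C\<^esub> \<tau> = \<tau> \<otimes>\<^bsub>code_Aut C\<^esub> \<sigma>"
  shows "CARD('n) = 1"
proof -
  obtain \<sigma> where C: "linear_code C" and \<sigma>: "\<sigma> \<in> code_automorphisms C"
      and cyc: "cyclic_on \<sigma> UNIV"
    using assms(1) by (auto simp: cyclic_code_def)
  obtain a where enum: "bij_betw (\<lambda>j. (\<sigma> ^^ j) a) {..<CARD('n)} UNIV"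
      and period: "\<sigma> ^^ CARD('n) = id"
    using cyclic_on_UNIV_enumeration[OF cyc] by blast
  have distinct: "i = j" if "(\<sigma> ^^ i) a = (\<sigma> ^^ j) a" "i < CARD('n)" "j < CARD('n)" for i j
    using enum that by (auto simp: bij_betw_def inj_on_def)
  interpret Aut: group "code_Aut C"
    by (rule group_code_Aut)
  have one: "\<one>\<^bsub>code_Aut C\<^esub> = id"
    by (simp add: code_Aut_def BijGroup_def restrict_UNIV id_def)

  have "odd CARD('n)"
  proof
    assume "even CARD('n)"
    then obtain k where k: "CARD('n) = k * 2"
      by (metis evenE mult.commute)
    have \<sigma>k: "\<sigma> ^^ k \<in> code_automorphisms C"
      using \<sigma> by (rule code_automorphisms_funpow)
    have "\<sigma> ^^ k = \<one>\<^bsub>code_Aut C\<^esub>"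
    proof (rule Aut.involution_eq_one_of_odd_order[OF odd])
      show "\<sigma> ^^ k \<in> carrier (code_Aut C)"
        using \<sigma>k by (simp add: code_Aut_def)
      show "(\<sigma> ^^ k) [^]\<^bsub>code_Aut C\<^esub> (2::nat) = \<one>\<^bsub>code_Aut C\<^esub>"
        using period by (simp add: code_Aut_pow[OF \<sigma>k] funpow_mult k one mult.commute)
    qed
    then have "\<sigma> ^^ k = id"
      by (simp add: one)
    then have "k = 0"
      using distinct[of k 0] k by (cases "k = 0") simp_all
    with k show False
      by simp
  qed
  then obtain \<mu> where \<mu>: "\<mu> \<in> code_automorphisms C"
      and \<mu>_enum: "\<And>j. \<mu> ((\<sigma> ^^ j) a) = (\<sigma> ^^ (2 * j)) a"
    using doubling_automorphism[OF C \<sigma> enum period] by blast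
  have bij: "bij \<sigma>" "bij \<mu>"
    using \<sigma> \<mu> by (simp_all add: code_automorphisms_def)
  then have "\<mu> (\<sigma> a) = \<sigma> (\<mu> a)"
    using comm[OF \<mu> \<sigma>] by (simp add: mult_code_Aut fun_eq_iff)
  then have "\<sigma> (\<sigma> a) = \<sigma> a"
    using \<mu>_enum[of 0] \<mu>_enum[of 1] by (simp add: numeral_2_eq_2)
  then have "\<sigma> a = a"
    using bij(1) by (simp add: bij_is_inj inj_eq)
  then have "\<not> 1 < CARD('n)"
    using distinct[of 1 0] by auto
  moreover have "CARD('n) > 0"
    by simp
  ultimately show ?thesis
    by linarith
qed

theorem proposition1:
  fixes C :: "(bit ^ 'n) set"
    and G :: "('g, 'm) monoid_scheme"
  assumes "cyclic_code C"
    and "group G" and "cyclic_group G" and "odd (order G)" and "\<not> trivial_group G"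
  shows "\<not> code_Aut C \<cong> G"
proof
  assume iso: "code_Aut C \<cong> G"
  have carrier: "carrier (code_Aut C) = code_automorphisms C"
    by (simp add: code_Aut_def)
  interpret G: group G
    by fact
  interpret Aut: group "code_Aut C"
    by (rule group_code_Aut)
  interpret G: comm_group G
    using G.cyclic_imp_abelian_group assms(3) by blast
  interpret Aut: comm_group "code_Aut C"
    using G.iso_imp_comm_group[OF Aut.iso_sym[OF iso] Aut.is_monoid] .
  have order: "order (code_Aut C) = order G"
    using iso_same_card[OF iso] by (simp add: order_def)
  have "odd (order (code_Aut C))"
    using assms(4) by (subst order)
  then have "CARD('n) = 1"
    using assms(1) carrier Aut.m_comm
    by (intro cyclic_code_abelian_odd_Aut_length) simp_all
  then have all_eq: "\<sigma> = \<tau>" for \<sigma> \<tau> :: "'n \<Rightarrow> 'n"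
    by (metis UNIV_I card_1_singletonE ext singletonD)
  have "trivial_group (code_Aut C)"
    unfolding Aut.trivial_group_subset using all_eq by blast
  then show False
    using isomorphic_group_triviality1[OF iso assms(2)] assms(5) by blast
qed

end
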